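(* Let an instance of the Capacitated Facility Location Problem with Customer Preferences (CFLCP) be given, with customers $I$, plants $J$, capacities $c_j$, opening costs $f_j$, allocation costs $g_{ij}$ and strict rankings $\prec_i$. Consider the integer linear model $$\min_{x,y}\ \sum_{j\in J} f_j y_j+\sum_{i\in I}\sum_{j\in J} g_{ij}x_{ij}$$ subject to $$\sum_{j\in J}x_{ij}=1\quad \forall i\in I,$$ $$\sum_{i\in I}x_{ij}\le c_jy_j\quad \forall j\in J,$$ $$x_{ij}\le y_j\quad \forall i\in I,\ j\in J,$$ $$c_jy_j\le c_j\sum_{j'\in J:\, j'\preceq_i j}x_{ij'}+\sum_{i'\in I\setminus\{i\}}x_{i'j}\quad \forall i\in I,\ j\in J,$$ $$x_{ij}\in\{0,1\}\quad \forall i\in I,\ j\in J,\qquad y_j\in\{0,1\}\quad \forall j\in J.$$ Then every feasible allocation provided by this model is customer stable; that is, for every feasible solution $(x,y)$, the allocation that opens exactly the plants $j$ with $y_j=1$ and assigns customer $i$ to the unique plant $j$ with $x_{ij}=1$ is customer stable.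
   Context: An instance of CFLCP consists of a finite set $J$ of potential plants, a finite set $I$ of customers, for each plant $j\in J$ an opening cost $f_j$ and a capacity $c_j$ (a positive integer, the maximum number of customers that can be allocated to $j$), for each pair $(i,j)\in I\times J$ an allocation cost $g_{ij}$, and for each customer $i\in I$ a strict total order $\prec_i$ on $J$, where $j\prec_i j'$ means that $i$ prefers $j$ to $j'$. One writes $j\preceq_i j'$ if $j\prec_i j'$ or $j=j'$. It is assumed that $c_j<|I|$ for at least one $j\in J$. A feasible allocation consists of a set of open plants together with an assignment of each customer to exactly one open plant such that at most $c_j$ customers are assigned to each plant $j$. In a feasible allocation $A$, a customer $i$ allocated to plant $j$ is a blocking customer if there is a plant $j'$ such that: (1) $i$ prefers $j'$ to $j$; (2) $j'$ is open; (3) fewer than $c_{j'}$ customers are allocated to $j'$ in $A$. The allocation $A$ is customer stable if it has no blocking customers. *)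

theory Defs
  imports Complex_Main
begin

text \<open>\<open>(j, j') \<in> pref P i\<close> means that customer \<open>i\<close> strictly prefers plant \<open>j\<close> to plant \<open>j'\<close>.\<close>

record ('i, 'j) cflcp =
  customers :: "'i set"
  plants :: "'j set"
  opening_cost :: "'j \<Rightarrow> real"
  capacity :: "'j \<Rightarrow> nat"
  allocation_cost :: "'i \<Rightarrow> 'j \<Rightarrow> real"
  pref :: "'i \<Rightarrow> 'j rel"

text \<open>\<open>strict_linear_order_on\<close> demands irreflexivity and transitivity on the whole type, so
  the rankings are taken to be relations on the set of plants only.\<close>

definition cflcp_instance :: "('i, 'j) cflcp \<Rightarrow> bool" where
  "cflcp_instance P \<longleftrightarrow>
     finite (customers P) \<and> finite (plants P) \<and>
     (\<forall>j\<in>plants P. 0 < capacity P j) \<and>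
     (\<forall>i\<in>customers P.
        pref P i \<subseteq> plants P \<times> plants P \<and> strict_linear_order_on (plants P) (pref P i)) \<and>
     (\<exists>j\<in>plants P. capacity P j < card (customers P))"

definition weakly_prefers :: "('i, 'j) cflcp \<Rightarrow> 'i \<Rightarrow> 'j \<Rightarrow> 'j \<Rightarrow> bool" where
  "weakly_prefers P i j j' \<longleftrightarrow> (j, j') \<in> pref P i \<or> j = j'"


text \<open>Only the values of \<open>assigned\<close> on the customers are meaningful.\<close>

record ('i, 'j) allocation =
  open_plants :: "'j set"
  assigned :: "'i \<Rightarrow> 'j"

definition load :: "('i, 'j) cflcp \<Rightarrow> ('i, 'j) allocation \<Rightarrow> 'j \<Rightarrow> nat" where
  "load P A j = card {i \<in> customers P. assigned A i = j}"

definition feasible_allocation :: "('i, 'j) cflcp \<Rightarrow> ('i, 'j) allocation \<Rightarrow> bool" where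
  "feasible_allocation P A \<longleftrightarrow>
     open_plants A \<subseteq> plants P \<and>
     (\<forall>i\<in>customers P. assigned A i \<in> open_plants A) \<and>
     (\<forall>j\<in>plants P. load P A j \<le> capacity P j)"

definition blocking_customer :: "('i, 'j) cflcp \<Rightarrow> ('i, 'j) allocation \<Rightarrow> 'i \<Rightarrow> bool" where
  "blocking_customer P A i \<longleftrightarrow>
     i \<in> customers P \<and>
     (\<exists>j'\<in>plants P. (j', assigned A i) \<in> pref P i \<and> j' \<in> open_plants A \<and>
        load P A j' < capacity P j')"

definition customer_stable :: "('i, 'j) cflcp \<Rightarrow> ('i, 'j) allocation \<Rightarrow> bool" where
  "customer_stable P A \<longleftrightarrow>
     feasible_allocation P A \<and> (\<nexists>i. blocking_customer P A i)"


record 'v minimization_model =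
  objective :: "'v \<Rightarrow> real"
  feasible_solutions :: "'v set"

definition cflcp_model ::
    "('i, 'j) cflcp \<Rightarrow> (('i \<Rightarrow> 'j \<Rightarrow> real) \<times> ('j \<Rightarrow> real)) minimization_model" where
  "cflcp_model P = (let I = customers P; J = plants P; c = (\<lambda>j. real (capacity P j)) in
     \<lparr> objective = (\<lambda>(x, y).
         (\<Sum>j\<in>J. opening_cost P j * y j) + (\<Sum>i\<in>I. \<Sum>j\<in>J. allocation_cost P i j * x i j)),
       feasible_solutions = {(x, y).
         (\<forall>i\<in>I. (\<Sum>j\<in>J. x i j) = 1) \<and>
         (\<forall>j\<in>J. (\<Sum>i\<in>I. x i j) \<le> c j * y j) \<and>
         (\<forall>i\<in>I. \<forall>j\<in>J. x i j \<le> y j) \<and>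
         (\<forall>i\<in>I. \<forall>j\<in>J. c j * y j \<le>
            c j * (\<Sum>j' | j' \<in> J \<and> weakly_prefers P i j' j. x i j') + (\<Sum>i'\<in>I - {i}. x i' j)) \<and>
         (\<forall>i\<in>I. \<forall>j\<in>J. x i j \<in> {0, 1}) \<and>
         (\<forall>j\<in>J. y j \<in> {0, 1})} \<rparr>)"

definition induced_allocation ::
    "('i, 'j) cflcp \<Rightarrow> ('i \<Rightarrow> 'j \<Rightarrow> real) \<Rightarrow> ('j \<Rightarrow> real) \<Rightarrow> ('i, 'j) allocation" where
  "induced_allocation P x y =
     \<lparr> open_plants = {j \<in> plants P. y j = 1},
       assigned = (\<lambda>i. THE j. j \<in> plants P \<and> x i j = 1) \<rparr>"

end

theory Submission
  imports Defs
begin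

text \<open>If a customer \<open>i\<close> assigned to \<open>j\<close> prefers the open plant \<open>j'\<close>, then \<open>i\<close> is assigned to no
  plant ranked at least as high as \<open>j'\<close>, so the first sum in the fourth constraint for \<open>(i, j')\<close>
  vanishes and the constraint forces \<open>j'\<close> to be full.\<close>

text \<open>A binary summand is its own indicator of the value 1. Applied to a row of
  \<open>x\<close> this counts the plants chosen by a customer, applied to a column it counts the
  customers of a plant.\<close>

lemma sum_binary_eq_card:
  fixes f :: "'a \<Rightarrow> 'b::semiring_1"
  assumes "finite S" and "\<forall>s\<in>S. f s \<in> {0, 1}"
  shows "(\<Sum>s\<in>S. f s) = of_nat (card {s \<in> S. f s = 1})"
proof -
  have "(\<Sum>s\<in>S. f s) = (\<Sum>s\<in>S. if f s = 1 then 1 else 0)"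
    using assms(2) by (intro sum.cong) auto
  also have "\<dots> = (\<Sum>s\<in>{s \<in> S. f s = 1}. 1)"
    using assms(1) by (rule sum.inter_filter [symmetric])
  finally show ?thesis by simp
qed

theorem proposition1:
  fixes P :: "('i, 'j) cflcp"
    and x :: "'i \<Rightarrow> 'j \<Rightarrow> real"
    and y :: "'j \<Rightarrow> real"
  assumes "cflcp_instance P"
    and "(x, y) \<in> feasible_solutions (cflcp_model P)"
  shows "(\<forall>i\<in>customers P. \<exists>!j. j \<in> plants P \<and> x i j = 1) \<and>
         customer_stable P (induced_allocation P x y)"
proof -
  let ?I = "customers P" and ?J = "plants P" and ?A = "induced_allocation P x y"
  have finI: "finite ?I" and finJ: "finite ?J"
    and order: "\<And>i. i \<in> ?I \<Longrightarrow> strict_linear_order_on ?J (pref P i)"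
    using assms(1) by (auto simp: cflcp_instance_def)
  have one: "(\<Sum>j\<in>?J. x i j) = 1" if "i \<in> ?I" for i
    using assms(2) that by (auto simp: cflcp_model_def Let_def)
  have cap: "(\<Sum>i\<in>?I. x i j) \<le> real (capacity P j) * y j" if "j \<in> ?J" for j
    using assms(2) that by (auto simp: cflcp_model_def Let_def)
  have le: "x i j \<le> y j" if "i \<in> ?I" "j \<in> ?J" for i j
    using assms(2) that by (auto simp: cflcp_model_def Let_def)
  have stab: "real (capacity P j) * y j \<le>
      real (capacity P j) * (\<Sum>j' | j' \<in> ?J \<and> weakly_prefers P i j' j. x i j') +
      (\<Sum>i'\<in>?I - {i}. x i' j)" if "i \<in> ?I" "j \<in> ?J" for i j
    using assms(2) that by (auto simp: cflcp_model_def Let_def)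
  have x01: "x i j \<in> {0, 1}" if "i \<in> ?I" "j \<in> ?J" for i j
    using assms(2) that by (auto simp: cflcp_model_def Let_def)
  have y01: "y j \<in> {0, 1}" if "j \<in> ?J" for j
    using assms(2) that by (auto simp: cflcp_model_def Let_def)

  have unique: "\<exists>!j. j \<in> ?J \<and> x i j = 1" if i: "i \<in> ?I" for i
  proof -
    \<comment> \<open>The row sum of customer \<open>i\<close> is 1 by the first constraint, and it
      counts the entries equal to 1.\<close>
    have "real (card {j \<in> ?J. x i j = 1}) = 1"
      using sum_binary_eq_card [of ?J "x i"] finJ x01 [OF i] one [OF i] by simp
    then obtain j where "{j \<in> ?J. x i j = 1} = {j}"
      by (auto simp: card_1_singleton_iff)
    then show ?thesis by (simp add: set_eq_iff)
  qed
  \<comment> \<open>The definite description in \<open>induced_allocation\<close> is meaningful only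
    because of \<open>unique\<close>.\<close>
  have assigned: "assigned ?A i \<in> ?J" "x i (assigned ?A i) = 1" if "i \<in> ?I" for i
    using theI' [OF unique [OF that]] by (auto simp: induced_allocation_def)
  have assigned_eq: "assigned ?A i = j \<longleftrightarrow> x i j = 1" if "i \<in> ?I" "j \<in> ?J" for i j
    using unique [OF that(1)] assigned [OF that(1)] that(2) by blast

  have load: "real (load P ?A j) = (\<Sum>i\<in>?I. x i j)" if j: "j \<in> ?J" for j
  proof -
    have "{i \<in> ?I. assigned ?A i = j} = {i \<in> ?I. x i j = 1}"
      using assigned_eq [OF _ j] by blast
    then show ?thesis
      using sum_binary_eq_card [of ?I "\<lambda>i. x i j"] finI x01 [OF _ j] by (simp add: load_def)
  qed

  have "feasible_allocation P ?A"
    unfolding feasible_allocation_def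
  proof (intro conjI ballI)
    show "open_plants ?A \<subseteq> ?J"
      by (auto simp: induced_allocation_def)
    show "assigned ?A i \<in> open_plants ?A" if i: "i \<in> ?I" for i
    proof -
      \<comment> \<open>Here 1 = \<open>x i (assigned ?A i)\<close> \<le>
        \<open>y (assigned ?A i)\<close>, and a binary value that is at least 1 equals 1.\<close>
      have "y (assigned ?A i) = 1"
        using le [OF i assigned(1) [OF i]] assigned(2) [OF i] y01 [OF assigned(1) [OF i]] by auto
      then show ?thesis
        using assigned(1) [OF i] by (simp add: induced_allocation_def)
    qed
    show "load P ?A j \<le> capacity P j" if j: "j \<in> ?J" for j
    proof -
      \<comment> \<open>The load is a column sum, bounded by capacity times \<open>y j\<close>, and
        \<open>y j\<close> is at most 1.\<close>
      have "real (load P ?A j) \<le> real (capacity P j)"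
        using load [OF j] cap [OF j] y01 [OF j] by auto
      then show ?thesis by simp
    qed
  qed
  moreover have "\<not> blocking_customer P ?A i" for i
  proof
    assume "blocking_customer P ?A i"
    then obtain j' where i: "i \<in> ?I" and j': "j' \<in> ?J"
      and prefers: "(j', assigned ?A i) \<in> pref P i"
      and "open": "y j' = 1" and room: "load P ?A j' < capacity P j'"
      by (auto simp: blocking_customer_def induced_allocation_def)
    \<comment> \<open>Otherwise equality, or transitivity in the strict case, would put
      \<open>(j', j')\<close> into \<open>pref P i\<close>, against irreflexivity.\<close>
    have "\<not> weakly_prefers P i (assigned ?A i) j'"
      using order [OF i] prefers
      unfolding weakly_prefers_def strict_linear_order_on_def
      by (metis irreflD transD)
    \<comment> \<open>The assigned plant is outside the index set, and every other binary entry in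
      the row of \<open>i\<close> is 0.\<close>
    then have "(\<Sum>k | k \<in> ?J \<and> weakly_prefers P i k j'. x i k) = 0"
      using x01 [OF i] assigned_eq [OF i] by (intro sum.neutral) blast
    then have "real (capacity P j') \<le> (\<Sum>i'\<in>?I - {i}. x i' j')"
      using stab [OF i j'] "open" by simp
    \<comment> \<open>Putting \<open>i\<close> back adds only the nonnegative term
      \<open>x i j'\<close> and turns the sum into the full load of \<open>j'\<close>.\<close>
    also have "\<dots> \<le> (\<Sum>i'\<in>?I. x i' j')"
      using finI x01 [OF _ j'] by (intro sum_mono2) fastforce+
    also have "\<dots> = real (load P ?A j')"
      using load [OF j'] by simp
    finally show False using room by simp
  qed
  ultimately show ?thesis
    using unique by (auto simp: customer_stable_def)
qed

end
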